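(* Let $k$ be a positive integer, let $G$ be a finite graph and let $X,Y\subseteq V(G)$. If there exist at least $2^{\chi_s'(G)}k$ pairwise vertex-disjoint $X$-$Y$-paths in $G$, then there exist $k$ pairwise non-adjacent $X$-$Y$-paths in $G$.
   Context: An $X$-$Y$-path is a path with one endpoint in $X$ and the other endpoint in $Y$; a single vertex of $X\cap Y$ counts as an $X$-$Y$-path (of length $0$). Paths are called pairwise non-adjacent if they are pairwise vertex-disjoint and there is no edge of $G$ joining a vertex of one of them to a vertex of another. An induced matching of $G$ is a set $M\subseteq E(G)$ such that any two distinct edges of $M$ share no vertex and no edge of $G$ joins an endpoint of one to an endpoint of the other. The strong chromatic index $\chi_s'(G)$ is the minimum number of induced matchings into which $E(G)$ can be partitioned. *)

theory Defs
  imports Main "HOL-Library.Disjoint_Sets"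
begin

definition finite_graph :: "'a set \<Rightarrow> 'a set set \<Rightarrow> bool" where
  "finite_graph V E \<longleftrightarrow> finite V \<and> (\<forall>e\<in>E. e \<subseteq> V \<and> card e = 2)"

definition is_path :: "'a set \<Rightarrow> 'a set set \<Rightarrow> 'a list \<Rightarrow> bool" where
  "is_path V E p \<longleftrightarrow>
     p \<noteq> [] \<and> distinct p \<and> set p \<subseteq> V \<and> successively (\<lambda>u v. {u, v} \<in> E) p"

text \<open>
  A path is represented by one of its two vertex sequences; the one starting in \<open>X\<close> is used
  here. A family of pairwise disjoint paths contains no path together with its reversal, so
  counting sequences is counting paths.
\<close>
definition XY_path :: "'a set \<Rightarrow> 'a set set \<Rightarrow> 'a set \<Rightarrow> 'a set \<Rightarrow> 'a list \<Rightarrow> bool" where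
  "XY_path V E X Y p \<longleftrightarrow> is_path V E p \<and> hd p \<in> X \<and> last p \<in> Y"

definition vertex_disjoint :: "'a list \<Rightarrow> 'a list \<Rightarrow> bool" where
  "vertex_disjoint p q \<longleftrightarrow> set p \<inter> set q = {}"

definition non_adjacent :: "'a set set \<Rightarrow> 'a list \<Rightarrow> 'a list \<Rightarrow> bool" where
  "non_adjacent E p q \<longleftrightarrow>
     vertex_disjoint p q \<and> \<not> (\<exists>u\<in>set p. \<exists>v\<in>set q. {u, v} \<in> E)"

definition induced_matching :: "'a set set \<Rightarrow> 'a set set \<Rightarrow> bool" where
  "induced_matching E M \<longleftrightarrow> M \<subseteq> E \<and>
     (\<forall>e\<in>M. \<forall>f\<in>M. e \<noteq> f \<longrightarrow>
        e \<inter> f = {} \<and> \<not> (\<exists>u\<in>e. \<exists>v\<in>f. {u, v} \<in> E))"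

definition strong_chromatic_index :: "'a set set \<Rightarrow> nat" where
  "strong_chromatic_index E =
     (LEAST n. \<exists>\<M>. partition_on E \<M> \<and> finite \<M> \<and>
                     (\<forall>M\<in>\<M>. induced_matching E M) \<and> card \<M> = n)"

lemma strong_chromatic_index_attained:
  assumes "finite_graph V E"
  shows "\<exists>\<M>. partition_on E \<M> \<and> finite \<M> \<and> (\<forall>M\<in>\<M>. induced_matching E M) \<and>
              card \<M> = strong_chromatic_index E"
proof -
  let ?S = "(\<lambda>e. {e}) ` E"
  have "finite E"
    using assms by (auto simp: finite_graph_def intro: finite_subset[of E "Pow V"])
  then have "partition_on E ?S \<and> finite ?S \<and> (\<forall>M\<in>?S. induced_matching E M) \<and> card ?S = card ?S"
    by (auto simp: partition_on_def disjoint_def induced_matching_def)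
  then have "\<exists>n \<M>. partition_on E \<M> \<and> finite \<M> \<and> (\<forall>M\<in>\<M>. induced_matching E M) \<and> card \<M> = n"
    by blast
  then show ?thesis
    unfolding strong_chromatic_index_def by (rule LeastI_ex)
qed

end

theory Submission imports Defs begin

text \<open>
  The colour classes are treated one at a time, each at the cost of half of the paths, while
  keeping a family \<open>P\<close> of disjoint \<open>X\<close>-\<open>Y\<close>-paths that are shortest inside their own vertex sets and hence
  induced. Let \<open>M\<close> be an induced matching. Contract the edges of \<open>M\<close> in the union of \<open>P\<close>: a separator of
  the contraction lifts to one of at most twice the size, so Menger's theorem gives half as many
  disjoint paths in the contraction. Their lifts \<open>Q\<close> use only edges of paths in \<open>P\<close> and edges of \<open>M\<close>, and
  no edge of \<open>M\<close> joins two of them. No other new adjacency arises either: if an edge \<open>ab \<notin> M\<close> has both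
  ends on one path of \<open>P\<close>, it is an edge of that path, and since \<open>M\<close> is induced one end, say \<open>b\<close>, is
  not covered by \<open>M\<close>. So a path of \<open>Q\<close> can pass through \<open>b\<close> only by following the old path, through \<open>a\<close>.
\<close>

section \<open>Menger's theorem\<close>

definition walk_between :: "('b \<times> 'b) set \<Rightarrow> 'b set \<Rightarrow> 'b set \<Rightarrow> 'b list \<Rightarrow> bool" where
  "walk_between R A B p \<longleftrightarrow>
     p \<noteq> [] \<and> hd p \<in> A \<and> last p \<in> B \<and> successively (\<lambda>u v. (u, v) \<in> R) p"

definition separates :: "('b \<times> 'b) set \<Rightarrow> 'b set \<Rightarrow> 'b set \<Rightarrow> 'b set \<Rightarrow> bool" where
  "separates R A B S \<longleftrightarrow> (\<forall>p. walk_between R A B p \<longrightarrow> set p \<inter> S \<noteq> {})"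

lemma walk_between_mono:
  "walk_between R A B p \<Longrightarrow> R \<subseteq> R' \<Longrightarrow> A \<subseteq> A' \<Longrightarrow> B \<subseteq> B' \<Longrightarrow> walk_between R' A' B' p"
  unfolding walk_between_def by (auto elim: successively_mono)

lemma walk_between_prefix:
  "walk_between R A B (p @ z # q) \<Longrightarrow> walk_between R A {z} (p @ [z])"
  unfolding walk_between_def by (auto simp: successively_append_iff hd_append)

lemma walk_between_suffix:
  "walk_between R A B (p @ z # q) \<Longrightarrow> walk_between R {z} B (z # q)"
  unfolding walk_between_def by (auto simp: successively_append_iff)

lemma walk_between_join:
  "walk_between R A C (p @ [z]) \<Longrightarrow> walk_between R D B (z # q) \<Longrightarrow> walk_between R A B (p @ z # q)"
  unfolding walk_between_def by (auto simp: successively_append_iff hd_append)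

lemma walk_between_append:
  assumes "walk_between R A C p" "walk_between R D B q" "(last p, hd q) \<in> R"
  shows "walk_between R A B (p @ q)"
  using assms unfolding walk_between_def by (auto simp: successively_append_iff)

text \<open>Cutting out the stretch between two occurrences of a vertex shortens the walk. Walks are
  allowed to repeat vertices so that they can be glued freely; this lemma turns them back into
  paths.\<close>

lemma walk_between_distinct:
  assumes "walk_between R A B p"
  obtains q where "walk_between R A B q" "distinct q" "set q \<subseteq> set p"
  using assms
proof (induction "length p" arbitrary: p thesis rule: less_induct)
  case less
  show ?case
  proof (cases "distinct p")
    case True
    then show ?thesis using less.prems by blast
  next
    case False
    then obtain xs y ys zs where p: "p = xs @ [y] @ ys @ [y] @ zs"
      using not_distinct_decomp by blast
    have "walk_between R A {y} (xs @ [y])" "walk_between R {y} B (y # zs)"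
      using less.prems(2) walk_between_prefix[of R A B xs y "ys @ y # zs"]
        walk_between_suffix[of R A B "xs @ y # ys" y zs] by (simp_all add: p)
    then have w: "walk_between R A B (xs @ y # zs)"
      by (rule walk_between_join)
    show ?thesis
    proof (rule less.hyps[OF _ _ w])
      show "length (xs @ y # zs) < length p" by (simp add: p)
      show thesis if "walk_between R A B q" "distinct q" "set q \<subseteq> set (xs @ y # zs)" for q
        by (rule less.prems(1)[OF that(1,2)]) (use that(3) in \<open>auto simp: p\<close>)
    qed
  qed
qed

text \<open>Each shortened walk stays inside the vertex set of its original, so disjointness
  survives; nonempty disjoint walks are different, so the number of walks survives too.\<close>

lemma disjoint_walks_distinct:
  assumes "\<forall>p\<in>P. walk_between R A B p" "pairwise vertex_disjoint P"
  obtains Q where "\<forall>q\<in>Q. walk_between R A B q \<and> distinct q" "pairwise vertex_disjoint Q"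
    "card Q = card P"
proof -
  have "\<forall>p\<in>P. \<exists>q. walk_between R A B q \<and> distinct q \<and> set q \<subseteq> set p"
    using assms(1) by (meson walk_between_distinct)
  then obtain g where g: "\<And>p. p \<in> P \<Longrightarrow> walk_between R A B (g p) \<and> distinct (g p) \<and> set (g p) \<subseteq> set p"
    by metis
  have disj: "set (g p) \<inter> set (g q) = {}" if "p \<in> P" "q \<in> P" "p \<noteq> q" for p q
    using g[OF that(1)] g[OF that(2)] assms(2) that
    by (fastforce simp: pairwise_def vertex_disjoint_def)
  have "inj_on g P"
    by (rule inj_onI) (metis disj g inf.idem set_empty walk_between_def)
  show thesis
  proof (rule that[of "g ` P"])
    show "\<forall>q\<in>g ` P. walk_between R A B q \<and> distinct q" using g by blast
    show "pairwise vertex_disjoint (g ` P)"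
      unfolding pairwise_def vertex_disjoint_def using disj by blast
    show "card (g ` P) = card P" using \<open>inj_on g P\<close> by (rule card_image)
  qed
qed

text \<open>Traversing \<open>(x, y)\<close> requires leaving \<open>x\<close>, hence an occurrence
  of \<open>x\<close> before the last position. \<open>butlast\<close> still admits walks that end
  in \<open>x\<close>, which is the case needed for walks to \<open>insert x S\<close>.\<close>

lemma walk_between_remove_arc_tail:
  assumes "walk_between (insert (x, y) R) A B p" "x \<notin> set (butlast p)"
  shows "walk_between R A B p"
proof -
  have "successively (\<lambda>u v. (u, v) \<in> insert (x, y) R) p \<Longrightarrow> x \<notin> set (butlast p)
    \<Longrightarrow> successively (\<lambda>u v. (u, v) \<in> R) p"
    by (induction p) (auto simp: successively_Cons split: if_splits)
  with assms show ?thesis unfolding walk_between_def by blast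
qed

lemma walk_between_remove_arc_head:
  assumes "walk_between (insert (x, y) R) A B p" "y \<notin> set (tl p)"
  shows "walk_between R A B p"
proof -
  have "successively (\<lambda>u v. (u, v) \<in> insert (x, y) R) p \<Longrightarrow> y \<notin> set (tl p)
    \<Longrightarrow> successively (\<lambda>u v. (u, v) \<in> R) p"
  proof (induction p)
    case (Cons a p)
    then show ?case by (cases p) auto
  qed simp
  with assms show ?thesis unfolding walk_between_def by blast
qed

section \<open>Separators and the insertion of an arc\<close>

lemma separates_insert_arc_tail:
  assumes "separates R A B S"
  shows "separates (insert (x, y) R) A B (insert x S)"
  unfolding separates_def
proof (intro allI impI)
  fix p assume p: "walk_between (insert (x, y) R) A B p"
  show "set p \<inter> insert x S \<noteq> {}"
  proof (cases "x \<in> set p")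
    case False
    then have "walk_between R A B p"
      using p walk_between_remove_arc_tail in_set_butlastD by metis
    then show ?thesis using assms unfolding separates_def by blast
  qed blast
qed

lemma separates_insert_arc_head:
  assumes "separates R A B S"
  shows "separates (insert (x, y) R) A B (insert y S)"
  unfolding separates_def
proof (intro allI impI)
  fix p assume p: "walk_between (insert (x, y) R) A B p"
  show "set p \<inter> insert y S \<noteq> {}"
  proof (cases "y \<in> set p")
    case False
    then have "walk_between R A B p"
      using p walk_between_remove_arc_head list.set_sel(2) by (metis list.sel(2))
    then show ?thesis using assms unfolding separates_def by blast
  qed blast
qed

text \<open>A walk only needs the arc \<open>(x, y)\<close> after it has already reached \<open>x\<close>.\<close>
lemma separates_upto_arc_tail:
  assumes "separates R A B S" "separates R A (insert x S) T"
  shows "separates (insert (x, y) R) A B T"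
  unfolding separates_def
proof (intro allI impI)
  fix p assume p: "walk_between (insert (x, y) R) A B p"
  have "\<exists>u\<in>set p. u \<in> insert x S"
    using separates_insert_arc_tail[OF assms(1), of x y] p unfolding separates_def by blast
  then obtain p1 u p2 where split: "p = p1 @ u # p2" and u: "u \<in> insert x S"
    and first: "\<forall>v\<in>set p1. v \<notin> insert x S"
    by (rule split_list_first_propE)
  have "walk_between (insert (x, y) R) A {u} (p1 @ [u])"
    using p walk_between_prefix unfolding split by metis
  then have "walk_between R A {u} (p1 @ [u])"
    by (rule walk_between_remove_arc_tail) (use first in auto)
  then have "walk_between R A (insert x S) (p1 @ [u])"
    by (rule walk_between_mono) (use u in auto)
  then show "set p \<inter> T \<noteq> {}"
    using assms(2) split unfolding separates_def by fastforce
qed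

text \<open>Mirror image of the preceding argument: after its last visit to
  \<open>insert y S\<close> a walk never enters \<open>y\<close> again, so this final segment runs
  in \<open>R\<close> and has to meet \<open>T\<close>.\<close>

lemma separates_from_arc_head:
  assumes "separates R A B S" "separates R (insert y S) B T"
  shows "separates (insert (x, y) R) A B T"
  unfolding separates_def
proof (intro allI impI)
  fix p assume p: "walk_between (insert (x, y) R) A B p"
  have "\<exists>u\<in>set p. u \<in> insert y S"
    using separates_insert_arc_head[OF assms(1), of x y] p unfolding separates_def by blast
  then obtain p1 u p2 where split: "p = p1 @ u # p2" and u: "u \<in> insert y S"
    and last: "\<forall>v\<in>set p2. v \<notin> insert y S"
    by (rule split_list_last_propE)
  have "walk_between (insert (x, y) R) {u} B (u # p2)"
    using p walk_between_suffix unfolding split by metis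
  then have "walk_between R {u} B (u # p2)"
    by (rule walk_between_remove_arc_head) (use last in auto)
  then have "walk_between R (insert y S) B (u # p2)"
    by (rule walk_between_mono) (use u in auto)
  then show "set p \<inter> T \<noteq> {}"
    using assms(2) split unfolding separates_def by fastforce
qed

section \<open>Systems of disjoint walks and Menger's theorem\<close>

lemma disjoint_walks_indexed:
  assumes "finite T" "card P = card T" "\<forall>p\<in>P. tip p \<in> set p \<inter> T" "pairwise vertex_disjoint P"
  obtains f where "\<And>t. t \<in> T \<Longrightarrow> f t \<in> P \<and> tip (f t) = t \<and> set (f t) \<inter> T = {t}"
    "\<And>s t. s \<in> T \<Longrightarrow> t \<in> T \<Longrightarrow> s \<noteq> t \<Longrightarrow> set (f s) \<inter> set (f t) = {}"
proof -
  \<comment> \<open>Disjointness makes \<open>tip\<close> injective, and equal cardinalities then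
    make it a bijection onto \<open>T\<close>. So every vertex of \<open>T\<close> is the tip of its
    own walk and lies on no other walk. Below, \<open>tip\<close> is \<open>last\<close> or
    \<open>hd\<close>.\<close>
  have "inj_on tip P"
  proof (rule inj_onI, rule ccontr)
    fix p q assume pq: "p \<in> P" "q \<in> P" "tip p = tip q" "p \<noteq> q"
    then have "set p \<inter> set q = {}"
      using assms(4) by (simp add: pairwise_def vertex_disjoint_def)
    moreover have "tip p \<in> set p" "tip p \<in> set q"
      using assms(3) pq(1-3) by (blast, metis IntD1)
    ultimately show False by blast
  qed
  then have "tip ` P = T"
    using assms(1-3) by (intro card_subset_eq) (auto simp: card_image)
  then have "\<forall>t\<in>T. \<exists>p\<in>P. tip p = t" by blast
  then obtain f where f: "\<And>t. t \<in> T \<Longrightarrow> f t \<in> P \<and> tip (f t) = t" by metis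
  have disj: "set (f s) \<inter> set (f t) = {}" if "s \<in> T" "t \<in> T" "s \<noteq> t" for s t
    using assms(4) f that unfolding pairwise_def vertex_disjoint_def by metis
  have mem: "t \<in> set (f t)" if "t \<in> T" for t
    using f[OF that] assms(3) by force
  have "set (f t) \<inter> T = {t}" if "t \<in> T" for t
    using disj mem that by blast
  then show thesis using f disj by (intro that[of f]) simp_all
qed

lemma disjoint_walks_card:
  assumes "finite T" "\<And>t. t \<in> T \<Longrightarrow> walk_between R A B (f t)"
    "\<And>s t. s \<in> T \<Longrightarrow> t \<in> T \<Longrightarrow> s \<noteq> t \<Longrightarrow> set (f s) \<inter> set (f t) = {}"
  shows "\<exists>P. finite P \<and> card P = card T \<and> (\<forall>p\<in>P. walk_between R A B p) \<and> pairwise vertex_disjoint P"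
proof (intro exI conjI)
  have "inj_on f T"
    by (rule inj_onI) (metis assms(2,3) inf.idem set_empty walk_between_def)
  then show "card (f ` T) = card T" by (rule card_image)
  show "finite (f ` T)" using assms(1) by simp
  show "\<forall>p\<in>f ` T. walk_between R A B p" using assms(2) by blast
  show "pairwise vertex_disjoint (f ` T)"
    unfolding pairwise_def vertex_disjoint_def using assms(3) by blast
qed

text \<open>Goering's proof: if deleting an arc \<open>(x, y)\<close> creates a separator \<open>S\<close> with fewer than \<open>k\<close>
  vertices, then \<open>k\<close> disjoint paths from \<open>A\<close> to \<open>S \<union> {x}\<close> and \<open>k\<close> from \<open>S \<union> {y}\<close> to \<open>B\<close> can be glued.\<close>
theorem menger:
  assumes "finite R" "finite A" "\<And>S. finite S \<Longrightarrow> separates R A B S \<Longrightarrow> k \<le> card S"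
  shows "\<exists>P. finite P \<and> card P = k \<and> (\<forall>p\<in>P. walk_between R A B p) \<and> pairwise vertex_disjoint P"
  using assms
proof (induction R arbitrary: A B rule: finite_induct)
  case empty
  have "p = [hd p]" if "walk_between {} A B p" for p
    using that by (cases p; cases "tl p") (auto simp: walk_between_def)
  \<comment> \<open>Without arcs every walk is a single vertex of \<open>A \<inter> B\<close>, so
    this set is a separator and its vertices serve as the paths.\<close>
  then have "separates {} A B (A \<inter> B)"
    unfolding separates_def walk_between_def
    by (metis IntI disjoint_iff last.simps list.set_sel(1))
  then have "k \<le> card (A \<inter> B)" using empty by blast
  then obtain T where T: "T \<subseteq> A \<inter> B" "card T = k" "finite T"
    by (meson obtain_subset_with_card_n)
  then show ?case
    using disjoint_walks_card[of T "{}" A B "\<lambda>t. [t]"] by (auto simp: walk_between_def)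
next
  case (insert e R)
  obtain x y where e: "e = (x, y)" by (cases e)
  show ?case
  proof (cases "\<forall>S. finite S \<longrightarrow> separates R A B S \<longrightarrow> k \<le> card S")
    case True
    then have "\<exists>P. finite P \<and> card P = k \<and> (\<forall>p\<in>P. walk_between R A B p) \<and> pairwise vertex_disjoint P"
      by (intro insert.IH[OF insert.prems(1)]) simp
    moreover have "walk_between (insert e R) A B p" if "walk_between R A B p" for p
      using that by (rule walk_between_mono) auto
    ultimately show ?thesis by blast
  next
    case False
    then obtain S where S: "finite S" "separates R A B S" "card S < k" by force
    \<comment> \<open>\<open>S\<close> together with either end of the arc separates in the full
      relation. As \<open>card S < k\<close>, both enlarged sets have exactly \<open>k\<close>
      elements, and neither end lies in \<open>S\<close>.\<close>
    have "k \<le> card (insert x S)" "k \<le> card (insert y S)"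
      using insert.prems(2) separates_insert_arc_tail[OF S(2), of x y]
        separates_insert_arc_head[OF S(2), of x y] S(1) by (simp_all add: e)
    then have cards: "card (insert x S) = k" "card (insert y S) = k" and "x \<notin> S" "y \<notin> S"
      using S(1,3) by (auto simp: card_insert_if split: if_splits)
    have "\<exists>P. finite P \<and> card P = k \<and> (\<forall>p\<in>P. walk_between R A (insert x S) p) \<and> pairwise vertex_disjoint P"
      by (rule insert.IH[OF insert.prems(1)], rule insert.prems(2))
        (use separates_upto_arc_tail[OF S(2)] e in auto)
    then obtain P0 where P0: "card P0 = k" "\<forall>p\<in>P0. walk_between R A (insert x S) p"
      "pairwise vertex_disjoint P0" by blast
    obtain P where P: "\<forall>p\<in>P. walk_between R A (insert x S) p \<and> distinct p"
      "pairwise vertex_disjoint P" "card P = card (insert x S)"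
      using P0(1) cards(1) by (auto intro: disjoint_walks_distinct[OF P0(2,3)])
    have "\<exists>P. finite P \<and> card P = k \<and> (\<forall>p\<in>P. walk_between R (insert y S) B p) \<and> pairwise vertex_disjoint P"
      by (rule insert.IH, use S(1) in simp, rule insert.prems(2))
        (use separates_from_arc_head[OF S(2)] e in auto)
    then obtain Q0 where Q0: "card Q0 = k" "\<forall>p\<in>Q0. walk_between R (insert y S) B p"
      "pairwise vertex_disjoint Q0" by blast
    obtain Q where Q: "\<forall>p\<in>Q. walk_between R (insert y S) B p \<and> distinct p"
      "pairwise vertex_disjoint Q" "card Q = card (insert y S)"
      using Q0(1) cards(2) by (auto intro: disjoint_walks_distinct[OF Q0(2,3)])
    obtain f where f: "\<And>t. t \<in> insert x S \<Longrightarrow> f t \<in> P \<and> last (f t) = t \<and> set (f t) \<inter> insert x S = {t}"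
      and f_disj: "\<And>s t. s \<in> insert x S \<Longrightarrow> t \<in> insert x S \<Longrightarrow> s \<noteq> t \<Longrightarrow> set (f s) \<inter> set (f t) = {}"
      by (rule disjoint_walks_indexed[of "insert x S" P last])
        (use P S(1) in \<open>auto simp: walk_between_def\<close>)
    obtain g where g: "\<And>t. t \<in> insert y S \<Longrightarrow> g t \<in> Q \<and> hd (g t) = t \<and> set (g t) \<inter> insert y S = {t}"
      and g_disj: "\<And>s t. s \<in> insert y S \<Longrightarrow> t \<in> insert y S \<Longrightarrow> s \<noteq> t \<Longrightarrow> set (g s) \<inter> set (g t) = {}"
      by (rule disjoint_walks_indexed[of "insert y S" Q hd])
        (use Q S(1) in \<open>auto simp: walk_between_def\<close>)
    \<comment> \<open>Following \<open>f s\<close> up to \<open>z\<close> and then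
      \<open>g t\<close> gives a walk from \<open>A\<close> to \<open>B\<close> in \<open>R\<close>,
      which must meet \<open>S\<close>. If \<open>z\<close> is not in \<open>S\<close>, the meeting
      point lies strictly before \<open>z\<close> on \<open>f s\<close> or strictly after
      \<open>z\<close> on \<open>g t\<close>. It would then be the end \<open>s\<close> or the start
      \<open>t\<close>, which also occurs on the other side of \<open>z\<close> or at
      \<open>z\<close>, against distinctness.\<close>
    have meet: "s = z \<and> t = z \<and> z \<in> S"
      if s: "s \<in> insert x S" and t: "t \<in> insert y S" and z: "z \<in> set (f s)" "z \<in> set (g t)" for s t z
    proof (cases "z \<in> S")
      case True
      then have "z \<in> set (f s) \<inter> insert x S" "z \<in> set (g t) \<inter> insert y S" using z by auto
      then show ?thesis using f[OF s] g[OF t] True by simp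
    next
      case False
      obtain f1 f2 where f12: "f s = f1 @ z # f2" using z(1) split_list by metis
      obtain g1 g2 where g12: "g t = g1 @ z # g2" using z(2) split_list by metis
      have walks: "walk_between R A (insert x S) (f s)" "distinct (f s)"
        "walk_between R (insert y S) B (g t)" "distinct (g t)"
        using f[OF s] g[OF t] P(1) Q(1) by blast+
      have "walk_between R A B (f1 @ z # g2)"
        using walks(1,3) walk_between_prefix walk_between_suffix walk_between_join
        unfolding f12 g12 by metis
      then obtain w where w: "w \<in> set (f1 @ z # g2)" "w \<in> S"
        using S(2) unfolding separates_def by blast
      consider "w \<in> set f1" | "w \<in> set g2" using w False by auto
      then show ?thesis
      proof cases
        case 1
        then have "w \<in> set (f s) \<inter> insert x S" using w(2) f12 by simp
        then have "w = s" using f[OF s] by simp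
        moreover have "s \<in> set (z # f2)"
          using f[OF s] f12 by (metis last_appendR last_in_set list.distinct(1))
        ultimately show ?thesis using 1 walks(2) f12 by auto
      next
        case 2
        then have "w \<in> set (g t) \<inter> insert y S" using w(2) g12 by simp
        then have "w = t" using g[OF t] by simp
        moreover have "t \<in> set (g1 @ [z])"
          using g[OF t] g12 by (cases g1) auto
        ultimately show ?thesis using 2 walks(4) g12 by auto
      qed
    qed
    \<comment> \<open>The walk ending in \<open>x\<close> continues over the new arc to the walk
      starting in \<open>y\<close>. For \<open>t \<in> S\<close> the two walks share the vertex
      \<open>t\<close>, which \<open>tl\<close> keeps from being repeated.\<close>
    define h where "h t = (if t = x then f x @ g y else f t @ tl (g t))" for t
    have h_walk: "walk_between (insert e R) A B (h t)" if t: "t \<in> insert x S" for t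
    proof (cases "t = x")
      case True
      have "walk_between (insert e R) A (insert x S) (f x)" "walk_between (insert e R) (insert y S) B (g y)"
        using f[of x] g[of y] P(1) Q(1) by (auto intro: walk_between_mono)
      moreover have "(last (f x), hd (g y)) \<in> insert e R" using f[of x] g[of y] e by simp
      ultimately have "walk_between (insert e R) A B (f x @ g y)" by (rule walk_between_append)
      then show ?thesis using True by (simp add: h_def)
    next
      case False
      then have "t \<in> S" using t by blast
      then have fg: "walk_between R A (insert x S) (f t)" "walk_between R (insert y S) B (g t)"
        "last (f t) = t" "hd (g t) = t"
        using f[of t] g[of t] P(1) Q(1) by auto
      then obtain f1 g2 where "f t = f1 @ [t]" "g t = t # g2"
        unfolding walk_between_def by (metis append_butlast_last_id list.collapse)
      then have "walk_between R A B (h t)"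
        using fg False walk_between_join[of R A "insert x S" f1 t "insert y S" B g2] by (simp add: h_def)
      then show ?thesis by (rule walk_between_mono) auto
    qed
    have h_set: "set (h t) \<subseteq> set (f t) \<union> set (g (if t = x then y else t))" for t
      unfolding h_def by (cases "g t") auto
    have h_disj: "set (h s) \<inter> set (h t) = {}" if st: "s \<in> insert x S" "t \<in> insert x S" "s \<noteq> t" for s t
    proof -
      \<comment> \<open>\<open>?c\<close> matches the ends of the first system with the starts of
        the second. A common vertex of \<open>f s\<close> and \<open>g (?c t)\<close> would by
        \<open>meet\<close> force \<open>s = ?c t \<in> S\<close>, impossible for
        \<open>s \<noteq> t\<close> and \<open>y \<notin> S\<close>.\<close>
      let ?c = "\<lambda>t. if t = x then y else t"
      have c: "?c s \<in> insert y S" "?c t \<in> insert y S" "?c s \<noteq> ?c t"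
        using st \<open>x \<notin> S\<close> \<open>y \<notin> S\<close> by (auto split: if_splits)
      have "set (f s) \<inter> set (g (?c t)) = {}" "set (f t) \<inter> set (g (?c s)) = {}"
        using meet[OF st(1) c(2)] meet[OF st(2) c(1)] st(3) \<open>y \<notin> S\<close>
        by (metis disjoint_iff)+
      then show ?thesis using f_disj[OF st] g_disj[OF c] h_set[of s] h_set[of t] by blast
    qed
    show ?thesis
      using disjoint_walks_card[of "insert x S", OF _ h_walk h_disj] S(1) unfolding cards(1) by simp
  qed
qed

section \<open>Rerouting along an induced matching\<close>

definition shortest_XY_path :: "'a set \<Rightarrow> 'a set set \<Rightarrow> 'a set \<Rightarrow> 'a set \<Rightarrow> 'a list \<Rightarrow> bool" where
  "shortest_XY_path V E X Y p \<longleftrightarrow> XY_path V E X Y p \<and>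
     (\<forall>q. XY_path V E X Y q \<longrightarrow> set q \<subseteq> set p \<longrightarrow> length p \<le> length q)"

lemma shortest_XY_path_exists:
  assumes "XY_path V E X Y p"
  obtains q where "shortest_XY_path V E X Y q" "set q \<subseteq> set p"
proof -
  define C where "C q \<longleftrightarrow> XY_path V E X Y q \<and> set q \<subseteq> set p" for q
  obtain q where q: "C q" "\<And>r. C r \<Longrightarrow> length q \<le> length r"
    using ex_has_least_nat[of C p length] assms unfolding C_def by blast
  then have "shortest_XY_path V E X Y q"
    unfolding shortest_XY_path_def C_def by blast
  with q(1) show thesis using that unfolding C_def by blast
qed

text \<open>A chord would replace the stretch between its ends and give a shorter path on a subset
  of the same vertices.\<close>

lemma shortest_XY_path_chordless:
  assumes p: "shortest_XY_path V E X Y p" and ij: "i < j" "j < length p" "{p ! i, p ! j} \<in> E"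
  shows "j = Suc i"
proof (rule ccontr)
  assume "j \<noteq> Suc i"
  let ?a = "take (Suc i) p" and ?b = "drop j p"
  have xy: "XY_path V E X Y p" using p by (simp add: shortest_XY_path_def)
  have "successively (\<lambda>u v. {u, v} \<in> E) (?a @ drop (Suc i) p)" "successively (\<lambda>u v. {u, v} \<in> E) (take j p @ ?b)"
    using xy by (simp_all add: XY_path_def is_path_def)
  then have "successively (\<lambda>u v. {u, v} \<in> E) ?a" "successively (\<lambda>u v. {u, v} \<in> E) ?b"
    unfolding successively_append_iff by blast+
  moreover have "last ?a = p ! i" "hd ?b = p ! j"
    using ij by (simp_all add: take_Suc_conv_app_nth hd_drop_conv_nth)
  ultimately have "successively (\<lambda>u v. {u, v} \<in> E) (?a @ ?b)"
    using ij(3) by (simp add: successively_append_iff)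
  moreover have "set ?a \<inter> set ?b = {}"
    using xy ij(1) by (intro set_take_disj_set_drop_if_distinct) (auto simp: XY_path_def is_path_def)
  moreover have "set (?a @ ?b) \<subseteq> set p"
    using set_take_subset[of "Suc i" p] set_drop_subset[of j p] by auto
  moreover have "hd (?a @ ?b) = hd p" "last (?a @ ?b) = last p"
    using ij by (cases p; simp)+
  ultimately have "XY_path V E X Y (?a @ ?b)"
    using xy ij unfolding XY_path_def is_path_def by auto
  then have "length p \<le> length (?a @ ?b)"
    using p \<open>set (?a @ ?b) \<subseteq> set p\<close> unfolding shortest_XY_path_def by blast
  then show False using ij \<open>j \<noteq> Suc i\<close> by simp
qed

text \<open>From a later vertex of \<open>X\<close> on, the rest of the path would be a shorter
  competitor.\<close>

lemma shortest_XY_path_start: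
  assumes p: "shortest_XY_path V E X Y p" and i: "i < length p" "p ! i \<in> X"
  shows "i = 0"
proof -
  have xy: "XY_path V E X Y p" using p by (simp add: shortest_XY_path_def)
  then have "successively (\<lambda>u v. {u, v} \<in> E) (take i p @ drop i p)"
    by (simp add: XY_path_def is_path_def)
  then have "successively (\<lambda>u v. {u, v} \<in> E) (drop i p)"
    unfolding successively_append_iff by blast
  then have "XY_path V E X Y (drop i p)"
    using xy i set_drop_subset[of i p] by (auto simp: XY_path_def is_path_def hd_drop_conv_nth)
  then have "length p \<le> length (drop i p)"
    using p set_drop_subset[of i p] unfolding shortest_XY_path_def by blast
  then show ?thesis using i by simp
qed

lemma shortest_XY_path_end:
  assumes p: "shortest_XY_path V E X Y p" and i: "i < length p" "p ! i \<in> Y"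
  shows "Suc i = length p"
proof -
  have xy: "XY_path V E X Y p" using p by (simp add: shortest_XY_path_def)
  then have "successively (\<lambda>u v. {u, v} \<in> E) (take (Suc i) p @ drop (Suc i) p)"
    by (simp add: XY_path_def is_path_def)
  then have "successively (\<lambda>u v. {u, v} \<in> E) (take (Suc i) p)"
    unfolding successively_append_iff by blast
  moreover have "last (take (Suc i) p) = p ! i" "hd (take (Suc i) p) = hd p" "take (Suc i) p \<noteq> []"
    using i by (simp add: take_Suc_conv_app_nth) (use i in \<open>cases p; simp\<close>)+
  ultimately have "XY_path V E X Y (take (Suc i) p)"
    using xy i set_take_subset[of "Suc i" p] by (auto simp: XY_path_def is_path_def)
  then have "length p \<le> length (take (Suc i) p)"
    using p set_take_subset[of "Suc i" p] unfolding shortest_XY_path_def by blast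
  then show ?thesis using i by simp
qed

text \<open>Inside \<open>p\<close> the vertex \<open>b\<close> has at most two neighbours, and \<open>q\<close> has to use all of them
  in order to pass through \<open>b\<close>, unless \<open>b\<close> is an end of \<open>q\<close> and hence of \<open>p\<close>.\<close>
lemma neighbour_on_path:
  assumes E: "\<And>e. e \<in> E \<Longrightarrow> card e = 2"
    and p: "shortest_XY_path V E X Y p" and ab: "a \<in> set p" "b \<in> set p" "{a, b} \<in> E"
    and q: "distinct q" "hd q \<in> X" "last q \<in> Y" "b \<in> set q"
    and loc: "successively (\<lambda>u v. u = b \<or> v = b \<longrightarrow> u \<in> set p \<and> v \<in> set p \<and> {u, v} \<in> E) q"
  shows "a \<in> set q"
proof -
  obtain i where i: "i < length p" "p ! i = b" using ab(2) by (auto simp: in_set_conv_nth)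
  obtain j where j: "j < length q" "q ! j = b" using q(4) by (auto simp: in_set_conv_nth)
  \<comment> \<open>As \<open>p\<close> has no chords and edges have two distinct ends, a neighbour
    of \<open>b = p ! i\<close> on \<open>p\<close> sits at position \<open>i - 1\<close> or
    \<open>i + 1\<close>.\<close>
  have nbr: "\<exists>l < length p. c = p ! l \<and> (l = Suc i \<or> Suc l = i)" if c: "c \<in> set p" "{c, b} \<in> E" for c
  proof -
    obtain l where l: "l < length p" "p ! l = c" using c(1) by (auto simp: in_set_conv_nth)
    have "l \<noteq> i" using E[OF c(2)] i(2) l(2) by auto
    then consider "l < i" | "i < l" by linarith
    then show ?thesis
    proof cases
      case 1
      then have "i = Suc l" using shortest_XY_path_chordless[OF p 1 i(1)] c(2) i l by simp
      then show ?thesis using l by auto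
    next
      case 2
      then have "l = Suc i"
        using shortest_XY_path_chordless[OF p 2 l(1)] c(2) i l by (simp add: insert_commute)
      then show ?thesis using l by auto
    qed
  qed
  obtain l where l: "l < length p" "a = p ! l" "l = Suc i \<or> Suc l = i" using nbr[OF ab(1,3)] by blast
  have pred: "\<exists>m < length p. q ! j' = p ! m \<and> (m = Suc i \<or> Suc m = i)" if "j = Suc j'" for j'
    using successively_nth[OF loc, of j'] j that nbr[of "q ! j'"] by auto
  have succ: "\<exists>m < length p. q ! Suc j = p ! m \<and> (m = Suc i \<or> Suc m = i)" if "Suc j < length q"
    using successively_nth[OF loc that] j nbr[of "q ! Suc j"] by (auto simp: insert_commute)
  have q0: "i = 0" if "j = 0"
    using shortest_XY_path_start[OF p i(1)] q(2) i(2) j that by (metis hd_conv_nth list.size(3) not_less_zero)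
  have q1: "Suc i = length p" if "Suc j = length q"
    using shortest_XY_path_end[OF p i(1)] q(3) i(2) j that
    by (metis diff_Suc_1 last_conv_nth list.size(3) not_less_zero)
  have mem: "q ! j' \<in> set q" if "j = Suc j'" for j' using j that by simp
  show ?thesis
  proof (cases j)
    case 0
    then have "i = 0" by (rule q0)
    then have "l = Suc 0" using l by auto
    \<comment> \<open>If \<open>b\<close> were also the last vertex of \<open>q\<close>, then
      \<open>p\<close> would be the single vertex \<open>b\<close>, leaving no room for
      \<open>a = p ! 1\<close>.\<close>
    then have "Suc j < length q" using q1 j \<open>i = 0\<close> l by fastforce
    then show ?thesis using succ l \<open>i = 0\<close> \<open>l = Suc 0\<close> nth_mem by fastforce
  next
    case (Suc j')
    then obtain m where m: "q ! j' = p ! m" "m = Suc i \<or> Suc m = i" "m < length p" using pred by blast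
    show ?thesis
    proof (cases "Suc j < length q")
      case True
      then obtain m' where m': "q ! Suc j = p ! m'" "m' = Suc i \<or> Suc m' = i" using succ by blast
      \<comment> \<open>The predecessor and the successor of \<open>b\<close> on \<open>q\<close>
        are two different vertices among at most two candidates on \<open>p\<close>, so one of them
        is \<open>a\<close>.\<close>
      have "q ! j' \<noteq> q ! Suc j"
        using q(1) True Suc by (simp add: nth_eq_iff_index_eq)
      then have "m \<noteq> m'" using m m' by auto
      then have "l = m \<or> l = m'" using l m m' by auto
      then show ?thesis using l m m' mem[OF Suc] True nth_mem by metis
    next
      case False
      then have "Suc i = length p" using q1 j by simp
      then have "l = m" using l m by auto
      then show ?thesis using l m mem[OF Suc] by simp
    qed
  qed
qed

text \<open>Here \<open>f\<close> sends a vertex to its class, and each arc of \<open>R\<close>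
  comes from an arc of \<open>H\<close> between two classes. Between the vertex where a class is
  entered and the vertex where it is left, at most one arc of \<open>L\<close> is inserted. The lift
  visits only classes on \<open>c\<close>, so disjoint walks have disjoint lifts.\<close>

lemma lift_walk:
  assumes R: "R \<subseteq> (\<lambda>(u, v). (f u, f v)) ` H" and HL: "H \<subseteq> L" "H \<subseteq> W \<times> W"
    and f: "\<And>u v. u \<in> W \<Longrightarrow> v \<in> W \<Longrightarrow> f u = f v \<Longrightarrow> u = v \<or> (u, v) \<in> L"
    and c: "walk_between R {f u} {f v} c" "u \<in> W" "v \<in> W"
  shows "\<exists>w. walk_between L {u} {v} w \<and> (\<forall>a\<in>set w. a \<in> W \<and> f a \<in> set c)"
  using c
proof (induction c arbitrary: u)
  case Nil
  then show ?case by (simp add: walk_between_def)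
next
  case (Cons z c)
  have hop: "\<exists>w. walk_between L {u} {t} w \<and> set w \<subseteq> {u, t}" if "t \<in> W" "f t = f u" for t
  proof (cases "u = t")
    case True
    then show ?thesis by (intro exI[of _ "[u]"]) (simp add: walk_between_def)
  next
    case False
    then show ?thesis using f[OF Cons.prems(2) that(1)] that(2)
      by (intro exI[of _ "[u, t]"]) (auto simp: walk_between_def)
  qed
  have z: "z = f u" using Cons.prems(1) by (simp add: walk_between_def)
  show ?case
  proof (cases "c = []")
    case True
    then have "f v = f u" using Cons.prems(1) by (auto simp: walk_between_def)
    then obtain w where "walk_between L {u} {v} w" "set w \<subseteq> {u, v}"
      using hop[OF Cons.prems(3)] by blast
    then show ?thesis using \<open>f v = f u\<close> z Cons.prems(2,3) by (intro exI[of _ w]) auto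
  next
    case False
    then have "(z, hd c) \<in> R" and c: "walk_between R {hd c} {f v} c"
      using Cons.prems(1) by (auto simp: walk_between_def successively_Cons)
    then obtain a b where ab: "(a, b) \<in> H" "z = f a" "hd c = f b" using R by auto
    then have W: "a \<in> W" "b \<in> W" using HL(2) by auto
    obtain w where w: "walk_between L {b} {v} w" "\<forall>a\<in>set w. a \<in> W \<and> f a \<in> set c"
      using Cons.IH[of b] c W(2) Cons.prems(3) ab(3) by auto
    obtain w' where w': "walk_between L {u} {a} w'" "set w' \<subseteq> {u, a}"
      using hop[OF W(1)] ab z by auto
    have "(last w', hd w) \<in> L" using w(1) w'(1) ab(1) HL(1) by (auto simp: walk_between_def)
    with w'(1) w(1) have "walk_between L {u} {v} (w' @ w)" by (rule walk_between_append)
    then show ?thesis using w(2) w'(2) z ab(2) W Cons.prems(2)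
      by (intro exI[of _ "w' @ w"]) auto
  qed
qed

section \<open>Crossing edges and their removal, one matching at a time\<close>

definition crossing_edges :: "'a set set \<Rightarrow> 'a list set \<Rightarrow> 'a set set" where
  "crossing_edges E P =
     {{a, b} | a b. {a, b} \<in> E \<and> (\<exists>p\<in>P. \<exists>q\<in>P. p \<noteq> q \<and> a \<in> set p \<and> b \<in> set q)}"

text \<open>Crossing edges are what prevents disjoint paths from being non-adjacent. Since the new
  ones lie among the old ones, an edge removed for one matching does not return when later matchings
  are treated.\<close>

lemma reroute:
  assumes G: "finite_graph V E" and M: "induced_matching E M"
    and P: "finite P" "2 * n \<le> card P" "\<forall>p\<in>P. shortest_XY_path V E X Y p"
      "pairwise vertex_disjoint P"
  obtains Q where "finite Q" "card Q = n" "\<forall>q\<in>Q. shortest_XY_path V E X Y q"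
    "pairwise vertex_disjoint Q" "crossing_edges E Q \<subseteq> crossing_edges E P - M"
proof -
  define W where "W = (\<Union>p\<in>P. set p)"
  \<comment> \<open>A vertex of the contraction is encoded as the set of vertices of
    \<open>W\<close> merged into it: \<open>u\<close> and its partner in \<open>M\<close>, if that
    lies in \<open>W\<close>. \<open>H\<close> holds the edges inside single paths, \<open>L\<close>
    also the edges of \<open>M\<close> within \<open>W\<close>, and \<open>R\<close> is the image of
    \<open>H\<close> in the contraction.\<close>
  define f where "f u = {v \<in> W. v = u \<or> {u, v} \<in> M}" for u
  define H where "H = {(u, v). \<exists>p\<in>P. u \<in> set p \<and> v \<in> set p \<and> {u, v} \<in> E}"
  define L where "L = H \<union> {(u, v). u \<in> W \<and> v \<in> W \<and> {u, v} \<in> M}"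
  define R where "R = (\<lambda>(u, v). (f u, f v)) ` H"
  have E2: "card e = 2" if "e \<in> E" for e
    using G that by (auto simp: finite_graph_def)
  have ME: "M \<subseteq> E" using M by (simp add: induced_matching_def)
  have M_eq: "e = e'" if "e \<in> M" "e' \<in> M" "u \<in> e" "u \<in> e'" for e e' u
    using M that unfolding induced_matching_def by blast
  have M_unique: "v = w" if "{u, v} \<in> M" "{u, w} \<in> M" for u v w
    using M_eq[OF that, of u] by (auto simp: doubleton_eq_iff)
  have P_XY: "XY_path V E X Y p" if "p \<in> P" for p
    using P(3) that by (simp add: shortest_XY_path_def)
  have WV: "W \<subseteq> V" unfolding W_def using P_XY by (fastforce simp: XY_path_def is_path_def)
  have "finite W" using P(1) by (simp add: W_def)
  have HW: "H \<subseteq> W \<times> W" by (auto simp: H_def W_def)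
  have f_self: "u \<in> f u" if "u \<in> W" for u using that by (simp add: f_def)
  have f_card: "card (f u) \<le> 2" for u
  proof (cases "\<exists>v. {u, v} \<in> M")
    case True
    then obtain v where "{u, v} \<in> M" by blast
    then have "f u \<subseteq> {u, v}" using M_unique by (auto simp: f_def)
    then have "card (f u) \<le> card {u, v}" by (intro card_mono) auto
    also have "\<dots> \<le> 2" by (simp add: card_insert_if)
    finally show ?thesis .
  next
    case False
    then have "f u \<subseteq> {u}" by (auto simp: f_def)
    then have "card (f u) \<le> card {u}" by (intro card_mono) auto
    then show ?thesis by simp
  qed
  have f_edge: "f u = f v" if "{u, v} \<in> M" "u \<in> W" "v \<in> W" for u v
  proof -
    have "{v, u} \<in> M" using that(1) by (simp add: insert_commute)
    then show ?thesis using that M_unique by (auto simp: f_def)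
  qed
  have f_eq: "u = v \<or> (u, v) \<in> L" if "u \<in> W" "v \<in> W" "f u = f v" for u v
  proof -
    have "v \<in> f u" using f_self[OF that(2)] that(3) by simp
    then show ?thesis using that by (auto simp: f_def L_def)
  qed
  \<comment> \<open>Each path of \<open>P\<close> maps to a walk in the contraction, so it contains
    a vertex whose class is in \<open>S\<close>. These vertices are distinct and a class has at most
    two vertices, so \<open>2 * n \<le> card P \<le> 2 * card S\<close>.\<close>
  have "n \<le> card S" if S: "finite S" "separates R (f ` (X \<inter> W)) (f ` (Y \<inter> W)) S" for S
  proof -
    have "\<exists>u\<in>set p. f u \<in> S" if p: "p \<in> P" for p
    proof -
      have xy: "p \<noteq> []" "hd p \<in> X" "last p \<in> Y" "successively (\<lambda>u v. {u, v} \<in> E) p"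
        using P_XY[OF p] by (auto simp: XY_path_def is_path_def)
      have "successively (\<lambda>u v. (f u, f v) \<in> R) p"
        by (rule successively_mono[OF xy(4)]) (use p in \<open>auto simp: R_def H_def\<close>)
      moreover have "hd p \<in> W" "last p \<in> W" using hd_in_set[OF xy(1)] last_in_set[OF xy(1)] p by (auto simp: W_def)
      ultimately have "walk_between R (f ` (X \<inter> W)) (f ` (Y \<inter> W)) (map f p)"
        using xy by (auto simp: walk_between_def successively_map hd_map last_map)
      then show ?thesis using S(2) unfolding separates_def by fastforce
    qed
    then obtain g where g: "\<And>p. p \<in> P \<Longrightarrow> g p \<in> set p \<and> f (g p) \<in> S" by metis
    have "inj_on g P"
      by (rule inj_onI) (metis P(4) disjoint_iff g pairwise_def vertex_disjoint_def)
    then have "card P = card (g ` P)" by (simp add: card_image)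
    also have "\<dots> \<le> card (\<Union>(S \<inter> f ` W))"
    proof (rule card_mono)
      show "finite (\<Union>(S \<inter> f ` W))"
        using \<open>finite W\<close> by (rule finite_subset[rotated]) (auto simp: f_def)
      show "g ` P \<subseteq> \<Union>(S \<inter> f ` W)"
      proof
        fix u assume "u \<in> g ` P"
        then obtain p where "p \<in> P" "u = g p" by blast
        then have "u \<in> W" "f u \<in> S" using g by (auto simp: W_def)
        then show "u \<in> \<Union>(S \<inter> f ` W)" using f_self by blast
      qed
    qed
    also have "\<dots> \<le> (\<Sum>A\<in>S \<inter> f ` W. card A)" by (rule card_Union_le_sum_card)
    also have "\<dots> \<le> of_nat (card (S \<inter> f ` W)) * 2"
      by (rule sum_bounded_above) (use f_card in auto)
    also have "\<dots> \<le> card S * 2" using S(1) by (simp add: card_mono)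
    finally show ?thesis using P(2) by simp
  qed
  moreover have "finite R" "finite (f ` (X \<inter> W))"
    using \<open>finite W\<close> HW finite_subset[of H "W \<times> W"] by (auto simp: R_def)
  ultimately obtain C where C: "finite C" "card C = n"
    "\<And>c. c \<in> C \<Longrightarrow> walk_between R (f ` (X \<inter> W)) (f ` (Y \<inter> W)) c" "pairwise vertex_disjoint C"
    using menger[of R "f ` (X \<inter> W)" "f ` (Y \<inter> W)" n] by blast
  have "\<exists>q. walk_between L X Y q \<and> distinct q \<and> (\<forall>a\<in>set q. a \<in> W \<and> f a \<in> set c)" if c: "c \<in> C" for c
  proof -
    obtain u v where uv: "u \<in> X \<inter> W" "v \<in> Y \<inter> W" "walk_between R {f u} {f v} c"
      using C(3)[OF c] by (auto simp: walk_between_def)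
    then obtain w where w: "walk_between L {u} {v} w" "\<forall>a\<in>set w. a \<in> W \<and> f a \<in> set c"
      using lift_walk[of R f H L W u v c] HW f_eq by (auto simp: R_def L_def)
    obtain q where q: "walk_between L {u} {v} q" "distinct q" "set q \<subseteq> set w"
      using w(1) by (rule walk_between_distinct)
    from q(1) have "walk_between L X Y q" by (rule walk_between_mono) (use uv in auto)
    with q w(2) show ?thesis by blast
  qed
  then obtain q where q: "\<And>c. c \<in> C \<Longrightarrow> walk_between L X Y (q c) \<and> distinct (q c) \<and>
      (\<forall>a\<in>set (q c). a \<in> W \<and> f a \<in> set c)"
    by metis
  have "\<exists>t. shortest_XY_path V E X Y t \<and> set t \<subseteq> set (q c)" if c: "c \<in> C" for c
  proof -
    have "successively (\<lambda>u v. (u, v) \<in> L) (q c)" using q[OF c] by (simp add: walk_between_def)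
    then have "successively (\<lambda>u v. {u, v} \<in> E) (q c)"
      by (rule successively_mono) (use ME in \<open>auto simp: L_def H_def\<close>)
    then have "XY_path V E X Y (q c)"
      using q[OF c] WV by (auto simp: XY_path_def is_path_def walk_between_def)
    then show ?thesis using shortest_XY_path_exists by metis
  qed
  then obtain t where t: "\<And>c. c \<in> C \<Longrightarrow> shortest_XY_path V E X Y (t c) \<and> set (t c) \<subseteq> set (q c)"
    by metis
  have q_disj: "set (q c) \<inter> set (q d) = {}" if "c \<in> C" "d \<in> C" "c \<noteq> d" for c d
  proof -
    have "set c \<inter> set d = {}" using C(4) that by (simp add: pairwise_def vertex_disjoint_def)
    then show ?thesis using q that by blast
  qed
  have t_disj: "set (t c) \<inter> set (t d) = {}" if "c \<in> C" "d \<in> C" "c \<noteq> d" for c d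
    using q_disj[OF that] t that by blast
  have t_ne: "t c \<noteq> []" if "c \<in> C" for c
    using t[OF that] by (simp add: shortest_XY_path_def XY_path_def is_path_def)
  have "inj_on t C"
    by (rule inj_onI) (metis inf.idem set_empty t_disj t_ne)
  \<comment> \<open>This concerns \<open>q c\<close>, whose steps lie in \<open>L\<close>, and not
    the shortened \<open>t c\<close>, which may use any edge of \<open>E\<close> among the vertices
    of \<open>q c\<close>. An unmatched \<open>b\<close> lies on \<open>p\<close> alone, so all
    steps of \<open>q c\<close> at \<open>b\<close> are edges inside \<open>p\<close>.\<close>
  have unmatched: "a \<in> set (q c)"
    if c: "c \<in> C" and p: "p \<in> P" and ab: "a \<in> set p" "b \<in> set p" "{a, b} \<in> E"
      and b: "b \<in> set (q c)" "\<And>v. {b, v} \<notin> M" for a b c p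
  proof (rule neighbour_on_path[OF E2 _ ab])
    show "shortest_XY_path V E X Y p" using P(3) p by blast
    show "distinct (q c)" "hd (q c) \<in> X" "last (q c) \<in> Y" "b \<in> set (q c)"
      using q[OF c] b(1) by (auto simp: walk_between_def)
    have same: "p' = p" if "p' \<in> P" "b \<in> set p'" for p'
      using P(4) p ab(2) that by (auto simp: pairwise_def vertex_disjoint_def)
    have "successively (\<lambda>u v. (u, v) \<in> L) (q c)" using q[OF c] by (simp add: walk_between_def)
    then show "successively (\<lambda>u v. u = b \<or> v = b \<longrightarrow> u \<in> set p \<and> v \<in> set p \<and> {u, v} \<in> E) (q c)"
    proof (rule successively_mono)
      fix u v assume "(u, v) \<in> L"
      then show "u = b \<or> v = b \<longrightarrow> u \<in> set p \<and> v \<in> set p \<and> {u, v} \<in> E"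
        using same b(2)[of u] b(2)[of v] by (auto simp: L_def H_def insert_commute)
    qed
  qed simp
  have cross: "{a, b} \<in> crossing_edges E P - M"
    if cd: "c \<in> C" "d \<in> C" "c \<noteq> d" and ab: "a \<in> set (t c)" "b \<in> set (t d)" "{a, b} \<in> E" for a b c d
  proof -
    have aq: "a \<in> set (q c)" and bq: "b \<in> set (q d)" using t cd ab by blast+
    then have W: "a \<in> W" "b \<in> W" and fc: "f a \<in> set c" "f b \<in> set d" using q cd by blast+
    have "set c \<inter> set d = {}" using C(4) cd by (simp add: pairwise_def vertex_disjoint_def)
    \<comment> \<open>An edge of \<open>M\<close> within \<open>W\<close> has both ends in one
      class, while \<open>c\<close> and \<open>d\<close> share no class.\<close>
    then have notM: "{a, b} \<notin> M" using f_edge[OF _ W] fc by auto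
    obtain p p' where p: "p \<in> P" "p' \<in> P" "a \<in> set p" "b \<in> set p'" using W by (auto simp: W_def)
    have "p \<noteq> p'"
    proof
      assume "p = p'"
      then have bp: "b \<in> set p" using p(4) by simp
      \<comment> \<open>If both ends were matched, their edges of \<open>M\<close> would either
        coincide, which puts \<open>{a, b}\<close> itself into \<open>M\<close>, or be joined by
        \<open>{a, b}\<close>, which contradicts that \<open>M\<close> is induced.\<close>
      have "(\<forall>v. {a, v} \<notin> M) \<or> (\<forall>v. {b, v} \<notin> M)"
      proof (rule ccontr)
        assume "\<not> ?thesis"
        then obtain v w where vw: "{a, v} \<in> M" "{b, w} \<in> M" by blast
        then show False
        proof (cases "{a, v} = {b, w}")
          case True
          moreover have "a \<noteq> b" using q_disj[OF cd] aq bq by blast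
          ultimately have "v = b" by (auto simp: doubleton_eq_iff)
          then show ?thesis using vw(1) notM by simp
        next
          case False
          then have "\<not> (\<exists>x\<in>{a, v}. \<exists>y\<in>{b, w}. {x, y} \<in> E)"
            using M vw unfolding induced_matching_def by meson
          then show ?thesis using ab(3) by simp
        qed
      qed
      then show False
      proof
        assume "\<forall>v. {a, v} \<notin> M"
        then have "b \<in> set (q c)"
          using unmatched[OF cd(1) p(1) bp p(3) _ aq] ab(3) by (simp add: insert_commute)
        then show False using q_disj[OF cd] bq by blast
      next
        assume "\<forall>v. {b, v} \<notin> M"
        then have "a \<in> set (q d)" using unmatched[OF cd(2) p(1) p(3) bp ab(3) bq] by blast
        then show False using q_disj[OF cd] aq by blast
      qed
    qed
    then show ?thesis using p ab(3) notM unfolding crossing_edges_def by blast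
  qed
  show thesis
  proof (rule that[of "t ` C"])
    show "finite (t ` C)" using C(1) by simp
    show "card (t ` C) = n" using \<open>inj_on t C\<close> C(2) by (simp add: card_image)
    show "\<forall>q\<in>t ` C. shortest_XY_path V E X Y q" using t by blast
    show "pairwise vertex_disjoint (t ` C)"
      unfolding pairwise_def vertex_disjoint_def using t_disj by blast
    show "crossing_edges E (t ` C) \<subseteq> crossing_edges E P - M"
    proof
      fix e assume "e \<in> crossing_edges E (t ` C)"
      then obtain a b c d where "e = {a, b}" "{a, b} \<in> E" "c \<in> C" "d \<in> C" "t c \<noteq> t d"
        "a \<in> set (t c)" "b \<in> set (t d)"
        unfolding crossing_edges_def by blast
      then show "e \<in> crossing_edges E P - M" using cross[of c d a b] by blast
    qed
  qed
qed

lemma reroute_all: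
  assumes "finite \<M>" "finite_graph V E" "\<forall>M\<in>\<M>. induced_matching E M"
    and "finite P" "2 ^ card \<M> * k \<le> card P" "\<forall>p\<in>P. shortest_XY_path V E X Y p"
      "pairwise vertex_disjoint P"
  shows "\<exists>Q. finite Q \<and> k \<le> card Q \<and> (\<forall>q\<in>Q. shortest_XY_path V E X Y q) \<and>
           pairwise vertex_disjoint Q \<and> crossing_edges E Q \<subseteq> crossing_edges E P - \<Union>\<M>"
  using assms(1,3-)
proof (induction \<M> arbitrary: P rule: finite_induct)
  case empty
  then show ?case by auto
next
  case (insert M \<M>)
  have M: "induced_matching E M" and \<M>: "\<forall>M\<in>\<M>. induced_matching E M" using insert.prems(1) by auto
  \<comment> \<open>One factor of two pays for \<open>M\<close>; the remaining power is what the
    induction hypothesis asks for.\<close>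
  have "2 * (2 ^ card \<M> * k) \<le> card P" using insert.prems(3) insert.hyps by simp
  then obtain P' where P': "finite P'" "card P' = 2 ^ card \<M> * k" "\<forall>p\<in>P'. shortest_XY_path V E X Y p"
    "pairwise vertex_disjoint P'" "crossing_edges E P' \<subseteq> crossing_edges E P - M"
    using reroute[OF assms(2) M insert.prems(2) _ insert.prems(4,5)] by metis
  obtain Q where "finite Q" "k \<le> card Q" "\<forall>q\<in>Q. shortest_XY_path V E X Y q"
    "pairwise vertex_disjoint Q" "crossing_edges E Q \<subseteq> crossing_edges E P' - \<Union>\<M>"
    using insert.IH[OF \<M> P'(1) _ P'(3,4)] P'(2) by auto
  with P'(5) show ?case by (intro exI[of _ Q]) auto
qed

theorem theorem1p6:
  fixes V X Y :: "'a set" and E :: "'a set set" and k :: nat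
  assumes "k > 0"
    and "finite_graph V E"
    and "X \<subseteq> V" and "Y \<subseteq> V"
    and "\<exists>P. finite P \<and> card P \<ge> 2 ^ strong_chromatic_index E * k \<and>
             (\<forall>p\<in>P. XY_path V E X Y p) \<and> pairwise vertex_disjoint P"
  shows "\<exists>Q. finite Q \<and> card Q = k \<and>
             (\<forall>q\<in>Q. XY_path V E X Y q) \<and> pairwise (non_adjacent E) Q"
proof -
  obtain P where P: "finite P" "card P \<ge> 2 ^ strong_chromatic_index E * k"
    "\<And>p. p \<in> P \<Longrightarrow> XY_path V E X Y p" "pairwise vertex_disjoint P"
    using assms(5) by blast
  obtain \<M> where \<M>: "partition_on E \<M>" "finite \<M>" "\<forall>M\<in>\<M>. induced_matching E M"
    "card \<M> = strong_chromatic_index E"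
    using strong_chromatic_index_attained[OF assms(2)] by blast
  \<comment> \<open>Shortening each path inside its own vertex set prepares the family for rerouting
    and keeps it disjoint.\<close>
  have "\<exists>q. shortest_XY_path V E X Y q \<and> set q \<subseteq> set p" if "p \<in> P" for p
    using shortest_XY_path_exists[OF P(3)[OF that]] by metis
  then obtain s where s: "\<And>p. p \<in> P \<Longrightarrow> shortest_XY_path V E X Y (s p) \<and> set (s p) \<subseteq> set p"
    by metis
  have s_disj: "set (s p) \<inter> set (s q) = {}" if "p \<in> P" "q \<in> P" "p \<noteq> q" for p q
  proof -
    have "set p \<inter> set q = {}" using P(4) that by (simp add: pairwise_def vertex_disjoint_def)
    then show ?thesis using s that by blast
  qed
  have s_ne: "s p \<noteq> []" if "p \<in> P" for p
    using s[OF that] by (simp add: shortest_XY_path_def XY_path_def is_path_def)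
  have "inj_on s P"
    by (rule inj_onI) (metis inf.idem set_empty s_disj s_ne)
  then have "card (s ` P) = card P" by (rule card_image)
  moreover have "pairwise vertex_disjoint (s ` P)"
    unfolding pairwise_def vertex_disjoint_def using s_disj by blast
  ultimately obtain Q where Q: "finite Q" "k \<le> card Q" "\<forall>q\<in>Q. shortest_XY_path V E X Y q"
    "pairwise vertex_disjoint Q" "crossing_edges E Q \<subseteq> crossing_edges E (s ` P) - \<Union>\<M>"
    using reroute_all[OF \<M>(2) assms(2) \<M>(3), of "s ` P" k X Y] P(1,2) \<M>(4) s by auto
  \<comment> \<open>The colour classes cover \<open>E\<close>, so removing all of them leaves no
    crossing edge.\<close>
  have "crossing_edges E (s ` P) \<subseteq> \<Union>\<M>"
    using partition_onD1[OF \<M>(1)] by (auto simp: crossing_edges_def)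
  then have none: "crossing_edges E Q = {}" using Q(5) by blast
  have "pairwise (non_adjacent E) Q"
    unfolding pairwise_def
  proof (intro ballI impI)
    fix p q assume pq: "p \<in> Q" "q \<in> Q" "p \<noteq> q"
    then have "{u, v} \<notin> E" if "u \<in> set p" "v \<in> set q" for u v
      using none that unfolding crossing_edges_def by blast
    then show "non_adjacent E p q"
      using Q(4) pq unfolding non_adjacent_def pairwise_def by blast
  qed
  moreover obtain Q' where "Q' \<subseteq> Q" "card Q' = k" "finite Q'"
    using Q(2) by (rule obtain_subset_with_card_n)
  ultimately show ?thesis
    using Q(3) pairwise_subset unfolding shortest_XY_path_def by blast
qed

end
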